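(* Let $G=(V,E)$ be a finite connected undirected graph without loops, $V=\{1,\dots,N\}$ with $N\ge 2$, let $\alpha\in(0,1)$, and let $(Z_i^t)_{i\in V,\,t\ge 0}$ be the proportions of black balls in the interacting urn process on $G$ with signal parameter $\alpha$. Let $\bar Z$ be the limit belief, i.e. the random variable with $Z_i^t\to\bar Z$ almost surely as $t\to\infty$ for every $i\in V$. Then the law of $\bar Z$ is non-degenerate (not a point mass) and has full support on $[0,1]$, i.e. $\mathbb{P}(\bar Z\in O)>0$ for every nonempty relatively open set $O\subseteq[0,1]$.
   Context: Interacting urn process on $G$ with parameter $\alpha$. Let $N(i)$ be the set of neighbors of $i$ in $G$ and $d_i=|N(i)|$ its degree. Each agent $i\in V$ has an urn containing white and black balls; $B_i^t$ and $W_i^t$ are the numbers of black and white balls in urn $i$ after step $t$, $S_i^t=B_i^t+W_i^t$, and $Z_i^t=B_i^t/S_i^t$ is the proportion of black balls. Initialization ($t=0$): each agent $i$, independently of the others, receives a signal that is correct with probability $\alpha$ and wrong with probability $1-\alpha$; urn $i$ initially contains exactly one ball, white if the signal is correct and black if it is wrong. So $S_i^0=1$. Dynamics: at each step $t+1$ ($t\ge 0$), each agent $i$ draws one ball uniformly at random from urn $i$, with replacement. Let $X_i^{t+1}\in\{0,1\}$ be the indicator that agent $i$'s draw is black. Let $\mathcal{F}_t$ be the sigma-field generated by the initial urn contents and all the draws $X^k=(X_1^k,\dots,X_N^k)$, $1\le k\le t$. Conditionally on $\mathcal{F}_t$, the variables $X_1^{t+1},\dots,X_N^{t+1}$ are independent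 and $\mathbb{P}(X_i^{t+1}=1\mid\mathcal{F}_t)=Z_i^t$. Each agent then adds to his urn one ball of the drawn color for each neighbor's draw: $$B_i^{t+1}=B_i^t+\sum_{j\in N(i)}X_j^{t+1},\qquad W_i^{t+1}=W_i^t+d_i-\sum_{j\in N(i)}X_j^{t+1},$$ so that $S_i^t=1+d_i t$. For connected $G$, the almost sure limits $\lim_{t\to\infty}Z_i^t$ exist and coincide for all $i\in V$, so $\bar Z$ is well defined almost surely. *)

theory Defs
  imports "HOL-Probability.Probability"
begin

definition simple_graph :: "'v set \<Rightarrow> 'v set set \<Rightarrow> bool" where
  "simple_graph V E \<longleftrightarrow> finite V \<and> (\<forall>e\<in>E. e \<subseteq> V \<and> card e = 2)"

definition neighbors :: "'v set set \<Rightarrow> 'v \<Rightarrow> 'v set" where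
  "neighbors E i = {j. {i, j} \<in> E}"

definition graph_connected :: "'v set \<Rightarrow> 'v set set \<Rightarrow> bool" where
  "graph_connected V E \<longleftrightarrow> (\<forall>u\<in>V. \<forall>v\<in>V. (u, v) \<in> {(x, y). y \<in> neighbors E x}\<^sup>*)"

text \<open>Conditional probability of an event given a sub-sigma-field, as a random variable.\<close>

definition prob_given :: "'a measure \<Rightarrow> 'a measure \<Rightarrow> 'a set \<Rightarrow> 'a \<Rightarrow> real" where
  "prob_given M F A = real_cond_exp M F (indicator A)"

definition cond_indep_vars ::
  "'a measure \<Rightarrow> 'a measure \<Rightarrow> ('i \<Rightarrow> 'b measure) \<Rightarrow> ('i \<Rightarrow> 'a \<Rightarrow> 'b) \<Rightarrow> 'i set \<Rightarrow> bool" where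
  "cond_indep_vars M F M' Y I \<longleftrightarrow>
     (\<forall>i\<in>I. Y i \<in> measurable M (M' i)) \<and>
     (\<forall>J. J \<subseteq> I \<and> finite J \<and> J \<noteq> {} \<longrightarrow>
       (\<forall>A\<in>Pi J (\<lambda>j. sets (M' j)).
         AE w in M. prob_given M F {w\<in>space M. \<forall>j\<in>J. Y j w \<in> A j} w
           = (\<Prod>j\<in>J. prob_given M F {w\<in>space M. Y j w \<in> A j} w)))"

text \<open>
  \<open>C i w\<close> says that the signal of agent \<open>i\<close> is correct; \<open>X i t w\<close> is the indicator
  that the draw of agent \<open>i\<close> at step \<open>t \<ge> 1\<close> is black (\<open>X i 0\<close> plays no role).
\<close>

primrec urn_black ::
  "'v set set \<Rightarrow> ('v \<Rightarrow> 'a \<Rightarrow> bool) \<Rightarrow> ('v \<Rightarrow> nat \<Rightarrow> 'a \<Rightarrow> nat) \<Rightarrow> 'v \<Rightarrow> nat \<Rightarrow> 'a \<Rightarrow> nat" where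
  "urn_black E C X i 0 w = (if C i w then 0 else 1)"
| "urn_black E C X i (Suc t) w = urn_black E C X i t w + (\<Sum>j\<in>neighbors E i. X j (Suc t) w)"

text \<open>As the draws are \<open>{0, 1}\<close>-valued, the subtraction below never truncates.\<close>

primrec urn_white ::
  "'v set set \<Rightarrow> ('v \<Rightarrow> 'a \<Rightarrow> bool) \<Rightarrow> ('v \<Rightarrow> nat \<Rightarrow> 'a \<Rightarrow> nat) \<Rightarrow> 'v \<Rightarrow> nat \<Rightarrow> 'a \<Rightarrow> nat" where
  "urn_white E C X i 0 w = (if C i w then 1 else 0)"
| "urn_white E C X i (Suc t) w =
     urn_white E C X i t w + card (neighbors E i) - (\<Sum>j\<in>neighbors E i. X j (Suc t) w)"

definition urn_total ::
  "'v set set \<Rightarrow> ('v \<Rightarrow> 'a \<Rightarrow> bool) \<Rightarrow> ('v \<Rightarrow> nat \<Rightarrow> 'a \<Rightarrow> nat) \<Rightarrow> 'v \<Rightarrow> nat \<Rightarrow> 'a \<Rightarrow> nat" where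
  "urn_total E C X i t w = urn_black E C X i t w + urn_white E C X i t w"

definition urn_prop ::
  "'v set set \<Rightarrow> ('v \<Rightarrow> 'a \<Rightarrow> bool) \<Rightarrow> ('v \<Rightarrow> nat \<Rightarrow> 'a \<Rightarrow> nat) \<Rightarrow> 'v \<Rightarrow> nat \<Rightarrow> 'a \<Rightarrow> real" where
  "urn_prop E C X i t w = real (urn_black E C X i t w) / real (urn_total E C X i t w)"

text \<open>The sigma-field generated by the initial urn contents and the draws of steps \<open>1, \<dots>, t\<close>.\<close>

definition urn_history ::
  "'a measure \<Rightarrow> 'v set \<Rightarrow> 'v set set \<Rightarrow> ('v \<Rightarrow> 'a \<Rightarrow> bool) \<Rightarrow> ('v \<Rightarrow> nat \<Rightarrow> 'a \<Rightarrow> nat) \<Rightarrow> nat \<Rightarrow> 'a measure" where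
  "urn_history M V E C X t = sigma (space M)
     ({urn_black E C X i 0 -` A \<inter> space M | i A. i \<in> V} \<union>
      {urn_white E C X i 0 -` A \<inter> space M | i A. i \<in> V} \<union>
      {X i k -` A \<inter> space M | i k A. i \<in> V \<and> k \<in> {1..t}})"

locale interacting_urn = prob_space M
  for M :: "'a measure"
    and V :: "'v set" and E :: "'v set set" and \<alpha> :: real
    and C :: "'v \<Rightarrow> 'a \<Rightarrow> bool" and X :: "'v \<Rightarrow> nat \<Rightarrow> 'a \<Rightarrow> nat" +
  assumes signals_indep: "indep_vars (\<lambda>_. count_space UNIV) C V"
    and signals_prob: "i \<in> V \<Longrightarrow> prob {w\<in>space M. C i w} = \<alpha>"
    and draws_cond_indep:
      "cond_indep_vars M (urn_history M V E C X t) (\<lambda>_. count_space {0, 1}) (\<lambda>i. X i (Suc t)) V"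
    and draws_prob:
      "i \<in> V \<Longrightarrow> AE w in M. prob_given M (urn_history M V E C X t) {w\<in>space M. X i (Suc t) w = 1} w
          = urn_prop E C X i t w"

end

theory Submission
  imports Defs
begin

text \<open>
  The degree-weighted sum of the proportions is almost a martingale: its drift at step \<open>t + 1\<close>
  is of order \<open>1 / t\<^sup>2\<close> and its increment of order \<open>1 / t\<close>. Hence, conditionally on the history
  up to time \<open>s\<close>, the mean square deviation of its limit from its value at time \<open>s\<close> is of order
  \<open>1 / s\<close>. For every \<open>p\<close> in the unit interval and every \<open>s\<close>, a suitable finite sequence of signals
  and draws has positive probability and brings all proportions to within \<open>3 / s\<close> of \<open>p\<close> at
  time \<open>s\<close>. By Chebyshev's inequality the limit is close to \<open>p\<close> with positive probability.
\<close>

text \<open>The graph enters through \<open>no_isolated\<close>, which a connected graph on at least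
  two vertices satisfies. It makes every degree at least 1 and lets every urn receive balls of a
  color other than its initial one.\<close>

locale isolated_free_urn = interacting_urn M V E \<alpha> C X
  for M :: "'a measure" and V :: "'v set" and E :: "'v set set" and \<alpha> :: real
    and C :: "'v \<Rightarrow> 'a \<Rightarrow> bool" and X :: "'v \<Rightarrow> nat \<Rightarrow> 'a \<Rightarrow> nat" +
  assumes graph: "simple_graph V E"
    and no_isolated: "i \<in> V \<Longrightarrow> neighbors E i \<noteq> {}"
begin

abbreviation deg :: "'v \<Rightarrow> nat" where
  "deg i \<equiv> card (neighbors E i)"

abbreviation Hist :: "nat \<Rightarrow> 'a measure" where
  "Hist \<equiv> urn_history M V E C X"

abbreviation Z :: "'v \<Rightarrow> nat \<Rightarrow> 'a \<Rightarrow> real" where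
  "Z \<equiv> urn_prop E C X"

section \<open>Elementary facts on the graph, the draws and the urn contents\<close>

lemma finite_V [simp]: "finite V"
  using graph by (simp add: simple_graph_def)

lemma neighbors_in_V: "j \<in> neighbors E i \<Longrightarrow> j \<in> V"
  using graph by (auto simp: simple_graph_def neighbors_def)

lemma neighbors_sym: "j \<in> neighbors E i \<longleftrightarrow> i \<in> neighbors E j"
  by (simp add: neighbors_def insert_commute)

lemma not_self_neighbor: "i \<notin> neighbors E i"
  using graph by (auto simp: simple_graph_def neighbors_def)

lemma finite_neighbors [simp]: "finite (neighbors E i)"
  by (rule finite_subset[OF _ finite_V]) (auto intro: neighbors_in_V)

lemma deg_ge_1: "i \<in> V \<Longrightarrow> deg i \<ge> 1"
  using no_isolated[of i] by (simp add: Suc_le_eq card_gt_0_iff)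

lemma draw_random_variable: "i \<in> V \<Longrightarrow> X i (Suc t) \<in> measurable M (count_space {0, 1})"
  using draws_cond_indep[of t] by (simp add: cond_indep_vars_def)

text \<open>Measurability into \<open>count_space {0, 1}\<close> forces the values at every point of
  the space, not only almost surely. Hence all later bounds on urn contents are pointwise.\<close>

lemma draw_binary: "i \<in> V \<Longrightarrow> w \<in> space M \<Longrightarrow> X i (Suc t) w \<in> {0, 1}"
  using measurable_space[OF draw_random_variable, of i w t] by simp

lemma draw_le_1: "i \<in> V \<Longrightarrow> w \<in> space M \<Longrightarrow> X i (Suc t) w \<le> 1"
  using draw_binary[of i w t] by auto

lemma draw_random_variable_UNIV: "i \<in> V \<Longrightarrow> X i (Suc t) \<in> measurable M (count_space UNIV)"
  using measurable_compose[OF draw_random_variable, of i "\<lambda>x. x" "count_space UNIV" t] by simp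

lemma signal_random_variable: "i \<in> V \<Longrightarrow> C i \<in> measurable M (count_space UNIV)"
  using signals_indep by (auto simp: indep_vars_def2)

lemma draw_sum_le: "w \<in> space M \<Longrightarrow> (\<Sum>j\<in>neighbors E i. X j (Suc t) w) \<le> deg i"
  using sum_bounded_above[of "neighbors E i" "\<lambda>j. X j (Suc t) w" 1] draw_le_1 neighbors_in_V
  by simp

text \<open>Since the draws of the neighbors sum to at most \<open>deg i\<close>, the natural
  subtraction in \<open>urn_white\<close> is exact and each step adds \<open>deg i\<close>
  balls.\<close>

lemma urn_total_eq: "w \<in> space M \<Longrightarrow> urn_total E C X i t w = 1 + deg i * t"
proof (induction t)
  case (Suc t)
  then show ?case
    using draw_sum_le[of w t i] by (simp add: urn_total_def)
qed (simp add: urn_total_def)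

lemma urn_prop_eq: "w \<in> space M \<Longrightarrow> Z i t w = real (urn_black E C X i t w) / (1 + deg i * t)"
  by (simp add: urn_prop_def urn_total_eq)

text \<open>No membership in \<open>space M\<close> is assumed: the total is by definition the sum
  of both counts, and a quotient by 0 has the value 0.\<close>

lemma urn_prop_bounds: "0 \<le> Z i t w" "Z i t w \<le> 1"
  by (auto simp: urn_prop_def urn_total_def divide_le_eq_1)

section \<open>The filtration generated by the urns\<close>

lemma urn_history_generators:
  "{urn_black E C X i 0 -` A \<inter> space M | i A. i \<in> V} \<union>
   {urn_white E C X i 0 -` A \<inter> space M | i A. i \<in> V} \<union>
   {X i k -` A \<inter> space M | i k A. i \<in> V \<and> k \<in> {1..t}} \<subseteq> Pow (space M)"
  by auto

lemma space_urn_history [simp]: "space (Hist t) = space M"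
  unfolding urn_history_def by (rule space_measure_of[OF urn_history_generators])

lemma urn_history_sets:
  "sets (Hist t) = sigma_sets (space M)
     ({urn_black E C X i 0 -` A \<inter> space M | i A. i \<in> V} \<union>
      {urn_white E C X i 0 -` A \<inter> space M | i A. i \<in> V} \<union>
      {X i k -` A \<inter> space M | i k A. i \<in> V \<and> k \<in> {1..t}})"
  unfolding urn_history_def by (rule sets_measure_of[OF urn_history_generators])

lemma urn_history_mono:
  assumes "s \<le> t"
  shows "sets (Hist s) \<subseteq> sets (Hist t)"
  unfolding urn_history_sets
proof (rule sigma_sets_mono', rule Un_mono[OF order_refl], rule subsetI)
  fix S assume "S \<in> {X i k -` A \<inter> space M | i k A. i \<in> V \<and> k \<in> {1..s}}"
  then obtain i k A where S: "S = X i k -` A \<inter> space M" "i \<in> V" and k: "k \<in> {1..s}"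
    by (elim CollectE exE conjE)
  have "k \<in> {1..t}"
    using k assms by simp
  with S show "S \<in> {X i k -` A \<inter> space M | i k A. i \<in> V \<and> k \<in> {1..t}}"
    by (intro CollectI exI[of _ i] exI[of _ k] exI[of _ A] conjI)
qed

lemma subalgebra_urn_history: "subalgebra M (Hist t)"
proof -
  have [measurable]: "Measurable.pred M (C i)" if "i \<in> V" for i
    using signal_random_variable[OF that] by simp
  have b: "urn_black E C X i 0 \<in> measurable M (count_space UNIV)" if [simp]: "i \<in> V" for i
    unfolding urn_black.simps by measurable
  have w: "urn_white E C X i 0 \<in> measurable M (count_space UNIV)" if [simp]: "i \<in> V" for i
    unfolding urn_white.simps by measurable
  have x: "X i k \<in> measurable M (count_space UNIV)" if "i \<in> V" "k \<in> {1..t}" for i k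
    using draw_random_variable_UNIV[OF that(1), of "k - 1"] that(2) by simp
  have "sets (Hist t) \<subseteq> sets M"
    unfolding urn_history_sets
    by (rule sets.sigma_sets_subset)
       (auto intro!: measurable_sets[OF b] measurable_sets[OF w] measurable_sets[OF x]
             simp del: urn_black.simps urn_white.simps)
  then show ?thesis
    by (simp add: subalgebra_def)
qed

sublocale hist: finite_measure_subalgebra M "Hist t" for t
  by unfold_locales (rule subalgebra_urn_history)

lemma history_measurable_imp: "f \<in> measurable (Hist t) N \<Longrightarrow> f \<in> measurable M N"
  by (rule measurable_from_subalg[OF subalgebra_urn_history])

lemma draw_history_measurable:
  assumes "i \<in> V" "k \<in> {1..t}"
  shows "X i k \<in> measurable (Hist t) (count_space UNIV)"
proof (rule measurableI)
  fix A :: "nat set"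
  show "X i k -` A \<inter> space (Hist t) \<in> sets (Hist t)"
    unfolding urn_history_sets space_urn_history
    by (rule sigma_sets.Basic) (use assms in blast)
qed simp

lemma urn_black_history_measurable:
  assumes "i \<in> V" "s \<le> t"
  shows "urn_black E C X i s \<in> measurable (Hist t) (count_space UNIV)"
  using assms(2)
proof (induction s)
  case 0
  show ?case
  proof (rule measurableI)
    fix A :: "nat set"
    show "urn_black E C X i 0 -` A \<inter> space (Hist t) \<in> sets (Hist t)"
      unfolding urn_history_sets space_urn_history
      by (intro sigma_sets.Basic UnI1 CollectI exI[of _ i] exI[of _ A] conjI refl assms(1))
  qed simp
next
  case (Suc s)
  \<comment> \<open>The Borel sets of \<open>nat\<close> are all its subsets, so the closure of
    Borel functions under addition and finite sums applies to integer counts.\<close>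
  have count: "measurable (Hist t) (borel :: nat measure) = measurable (Hist t) (count_space UNIV)"
    by (rule measurable_cong_sets[OF refl sets_borel_eq_count_space])
  have black: "urn_black E C X i s \<in> borel_measurable (Hist t)"
    unfolding count by (rule Suc.IH) (use Suc.prems in simp)
  have draw: "X j (Suc s) \<in> borel_measurable (Hist t)" if "j \<in> neighbors E i" for j
    unfolding count by (rule draw_history_measurable) (use that neighbors_in_V Suc.prems in auto)
  have "(\<lambda>w. urn_black E C X i s w + (\<Sum>j\<in>neighbors E i. X j (Suc s) w)) \<in> borel_measurable (Hist t)"
    by (intro borel_measurable_add borel_measurable_sum black draw)
  then show ?case
    unfolding count urn_black.simps .
qed

lemma urn_prop_history_measurable:
  assumes "i \<in> V" "s \<le> t"
  shows "Z i s \<in> borel_measurable (Hist t)"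
proof -
  have [measurable]: "urn_black E C X i s \<in> measurable (Hist t) (count_space UNIV)"
    by (rule urn_black_history_measurable[OF assms])
  have "(\<lambda>w. real (urn_black E C X i s w) / (1 + deg i * s)) \<in> borel_measurable (Hist t)"
    by measurable
  moreover have "Z i s \<in> borel_measurable (Hist t)
    \<longleftrightarrow> (\<lambda>w. real (urn_black E C X i s w) / (1 + deg i * s)) \<in> borel_measurable (Hist t)"
    by (rule measurable_cong) (simp add: urn_prop_eq)
  ultimately show ?thesis
    by simp
qed

lemma urn_prop_measurable [measurable]: "i \<in> V \<Longrightarrow> Z i t \<in> borel_measurable M"
  by (rule history_measurable_imp[OF urn_prop_history_measurable[OF _ order_refl]])

text \<open>The history is generated by ball counts, not by signals; the initial number of black
  balls, 0 or 1, recovers the signal.\<close>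

lemma signal_history_measurable:
  assumes "i \<in> V"
  shows "{w \<in> space M. C i w = c} \<in> sets (Hist t)"
proof -
  have "urn_black E C X i 0 -` {if c then 0 else 1} \<inter> space (Hist t) \<in> sets (Hist t)"
    by (rule measurable_sets[OF urn_black_history_measurable]) (use assms in auto)
  also have "urn_black E C X i 0 -` {if c then 0 else 1} \<inter> space (Hist t) = {w \<in> space M. C i w = c}"
    by (auto split: if_splits)
  finally show ?thesis .
qed

section \<open>Conditional law of a single draw\<close>

text \<open>A black draw is covered by \<open>draws_prob\<close>. The indicator of a white draw is 1
  minus that of a black one, so linearity of conditional expectation gives the other case.\<close>

lemma prob_given_draw:
  assumes "i \<in> V" "x \<in> {0, 1}"
  shows "AE w in M. prob_given M (Hist t) {w\<in>space M. X i (Suc t) w = x} w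
           = (if x = 1 then Z i t w else 1 - Z i t w)"
proof (cases "x = 1")
  case True
  then show ?thesis
    using draws_prob[OF assms(1), of t] by simp
next
  case False
  with assms have x: "x = 0" by simp
  have [measurable]: "X i (Suc t) \<in> measurable M (count_space UNIV)"
    by (rule draw_random_variable_UNIV[OF assms(1)])
  let ?A = "\<lambda>x. {w\<in>space M. X i (Suc t) w = x}"
  have int: "integrable M (indicator (?A 1) :: 'a \<Rightarrow> real)"
    by (intro integrable_real_indicator) (auto simp: emeasure_eq_measure)
  have "AE w in M. real_cond_exp M (Hist t) (indicator (?A 0)) w
          = real_cond_exp M (Hist t) (\<lambda>w. 1 - indicator (?A 1) w) w"
  proof (rule hist.real_cond_exp_cong)
    show "AE w in M. indicator (?A 0) w = 1 - (indicator (?A 1) w :: real)"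
    proof (rule AE_I2)
      fix w assume "w \<in> space M"
      then have "X i (Suc t) w = 0 \<or> X i (Suc t) w = 1"
        using draw_binary[OF assms(1), of w t] by simp
      then show "indicator (?A 0) w = 1 - (indicator (?A 1) w :: real)"
        using \<open>w \<in> space M\<close> by auto
    qed
  qed measurable
  moreover have "AE w in M. real_cond_exp M (Hist t) (\<lambda>w. 1 - indicator (?A 1) w) w
      = real_cond_exp M (Hist t) (\<lambda>w. 1) w - real_cond_exp M (Hist t) (indicator (?A 1)) w"
    by (rule hist.real_cond_exp_diff[OF _ int]) simp
  moreover have "AE w in M. real_cond_exp M (Hist t) (\<lambda>w. 1) w = 1"
    by (rule hist.real_cond_exp_F_meas) auto
  moreover note draws_prob[OF assms(1), of t]
  ultimately show ?thesis
    unfolding x prob_given_def by eventually_elim simp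
qed

text \<open>The centered draw is a martingale difference. Against a bounded history-measurable
  \<open>f\<close>, the indicator of a black draw may be replaced under the integral by its
  conditional expectation \<open>Z i t\<close>.\<close>

lemma integral_mult_draw_diff:
  fixes f :: "'a \<Rightarrow> real"
  assumes "i \<in> V" and f: "f \<in> borel_measurable (Hist t)"
    and bound: "\<And>w. w \<in> space M \<Longrightarrow> \<bar>f w\<bar> \<le> B"
  shows "integrable M (\<lambda>w. f w * (real (X i (Suc t) w) - Z i t w))"
    and "(\<integral>w. f w * (real (X i (Suc t) w) - Z i t w) \<partial>M) = 0"
proof -
  let ?A = "{w\<in>space M. X i (Suc t) w = 1}"
  have [measurable]: "f \<in> borel_measurable M"
    by (rule history_measurable_imp[OF f])
  have [measurable]: "X i (Suc t) \<in> measurable M (count_space UNIV)"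
    by (rule draw_random_variable_UNIV[OF assms(1)])
  note [measurable] = urn_prop_measurable[OF assms(1)]
  have fX: "integrable M (\<lambda>w. f w * indicator ?A w)"
  proof (rule integrable_const_bound[of _ B])
    show "AE w in M. norm (f w * indicator ?A w) \<le> B"
    proof (rule AE_I2)
      fix w assume "w \<in> space M"
      then show "norm (f w * indicator ?A w) \<le> B"
        using bound[of w] by (cases "w \<in> ?A") auto
    qed
  qed measurable
  have fZ: "integrable M (\<lambda>w. f w * Z i t w)"
  proof (rule integrable_const_bound[of _ B])
    show "AE w in M. norm (f w * Z i t w) \<le> B"
    proof (rule AE_I2)
      fix w assume "w \<in> space M"
      have "norm (f w * Z i t w) = \<bar>f w\<bar> * Z i t w"
        by (simp add: abs_mult urn_prop_bounds)
      also have "\<dots> \<le> \<bar>f w\<bar>"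
        by (rule mult_right_le_one_le) (auto simp: urn_prop_bounds)
      also note bound[OF \<open>w \<in> space M\<close>]
      finally show "norm (f w * Z i t w) \<le> B" .
    qed
  qed measurable
  have "(\<integral>w. f w * indicator ?A w \<partial>M)
      = (\<integral>w. f w * real_cond_exp M (Hist t) (indicator ?A) w \<partial>M)"
    by (rule hist.real_cond_exp_intg(2)[OF fX f, symmetric]) simp
  also have "\<dots> = (\<integral>w. f w * Z i t w \<partial>M)"
    using draws_prob[OF assms(1), of t] by (intro integral_cong_AE) (auto simp: prob_given_def)
  finally have eq: "(\<integral>w. f w * indicator ?A w \<partial>M) = (\<integral>w. f w * Z i t w \<partial>M)" .
  have *: "f w * (real (X i (Suc t) w) - Z i t w) = f w * indicator ?A w - f w * Z i t w"
    if "w \<in> space M" for w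
    using draw_binary[OF assms(1) that, of t] that by (auto simp: algebra_simps indicator_def)
  show "integrable M (\<lambda>w. f w * (real (X i (Suc t) w) - Z i t w))"
    by (rule Bochner_Integration.integrable_cong[THEN iffD2,
          OF refl * Bochner_Integration.integrable_diff[OF fX fZ]])
  show "(\<integral>w. f w * (real (X i (Suc t) w) - Z i t w) \<partial>M) = 0"
    by (subst Bochner_Integration.integral_cong[OF refl *], assumption)
       (use eq Bochner_Integration.integral_diff[OF fX fZ] in simp)
qed

section \<open>The degree-weighted proportion, its drift and its increments\<close>

definition total_deg :: real where
  "total_deg = (\<Sum>i\<in>V. real (deg i))"

text \<open>One neighbor moves \<open>Z i\<close> at a rate of about \<open>1 / (deg i * t)\<close>.
  The weight \<open>deg i\<close> equalizes these rates, so that the mean influences of two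
  neighbors on each other cancel to leading order.\<close>

definition weighted_prop :: "nat \<Rightarrow> 'a \<Rightarrow> real" where
  "weighted_prop t w = (\<Sum>i\<in>V. deg i * Z i t w)"

text \<open>The conditional mean of the increment of \<open>weighted_prop\<close> from
  \<open>t\<close> to \<open>Suc t\<close>, given the history up to \<open>t\<close>.\<close>

definition drift :: "nat \<Rightarrow> 'a \<Rightarrow> real" where
  "drift t w = (\<Sum>i\<in>V. deg i / (1 + deg i * Suc t) * ((\<Sum>j\<in>neighbors E i. Z j t w) - deg i * Z i t w))"

lemma total_deg_nonneg: "0 \<le> total_deg"
  by (simp add: total_deg_def sum_nonneg)

lemma weighted_prop_bounds: "0 \<le> weighted_prop t w" "weighted_prop t w \<le> total_deg"
  by (auto simp: weighted_prop_def total_deg_def urn_prop_bounds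
           intro!: sum_nonneg sum_mono mult_right_le_one_le)

lemma weighted_prop_history_measurable: "weighted_prop t \<in> borel_measurable (Hist t)"
  unfolding weighted_prop_def
  by (intro borel_measurable_sum borel_measurable_times urn_prop_history_measurable) auto

lemma weighted_prop_measurable [measurable]: "weighted_prop t \<in> borel_measurable M"
  by (rule history_measurable_imp[OF weighted_prop_history_measurable])

lemma drift_measurable [measurable]: "drift t \<in> borel_measurable M"
  unfolding drift_def
  by (intro borel_measurable_sum borel_measurable_times borel_measurable_diff urn_prop_measurable
        borel_measurable_const) (auto intro: neighbors_in_V)

lemma urn_prop_step:
  assumes "w \<in> space M"
  shows "Z i (Suc t) w - Z i t w
       = (real (\<Sum>j\<in>neighbors E i. X j (Suc t) w) - deg i * Z i t w) / (1 + deg i * Suc t)"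
proof -
  have "1 + real (deg i) * real t > 0" "1 + real (deg i) * real (Suc t) > 0"
    by (auto intro: add_pos_nonneg)
  then show ?thesis
    by (simp add: urn_prop_eq[OF assms] divide_simps) (simp add: algebra_simps)
qed

text \<open>Doob decomposition of one step: replacing each draw by its conditional mean
  \<open>Z j t\<close> leaves a linear combination of centered draws.\<close>

lemma weighted_prop_step:
  assumes "w \<in> space M"
  shows "weighted_prop (Suc t) w - weighted_prop t w = drift t w
       + (\<Sum>i\<in>V. \<Sum>j\<in>neighbors E i. deg i / (1 + deg i * Suc t) * (real (X j (Suc t) w) - Z j t w))"
proof -
  have "weighted_prop (Suc t) w - weighted_prop t w = (\<Sum>i\<in>V. deg i * (Z i (Suc t) w - Z i t w))"
    by (simp add: weighted_prop_def sum_subtractf right_diff_distrib)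
  also have "\<dots> = (\<Sum>i\<in>V. deg i / (1 + deg i * Suc t) * ((\<Sum>j\<in>neighbors E i. Z j t w) - deg i * Z i t w)
      + (\<Sum>j\<in>neighbors E i. deg i / (1 + deg i * Suc t) * (real (X j (Suc t) w) - Z j t w)))"
  proof (rule sum.cong[OF refl])
    fix i
    define c where "c = deg i / (1 + real (deg i * Suc t))"
    have "deg i * (Z i (Suc t) w - Z i t w)
        = c * (real (\<Sum>j\<in>neighbors E i. X j (Suc t) w) - deg i * Z i t w)"
      by (simp add: urn_prop_step[OF assms] c_def)
    also have "\<dots> = c * ((\<Sum>j\<in>neighbors E i. Z j t w) - deg i * Z i t w)
        + c * (\<Sum>j\<in>neighbors E i. real (X j (Suc t) w) - Z j t w)"
      by (simp add: sum_subtractf algebra_simps)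
    finally show "deg i * (Z i (Suc t) w - Z i t w)
        = deg i / (1 + deg i * Suc t) * ((\<Sum>j\<in>neighbors E i. Z j t w) - deg i * Z i t w)
          + (\<Sum>j\<in>neighbors E i. deg i / (1 + deg i * Suc t) * (real (X j (Suc t) w) - Z j t w))"
      by (simp add: c_def sum_distrib_left)
  qed
  finally show ?thesis
    by (simp add: drift_def sum.distrib)
qed

text \<open>Both terms lie between 0 and \<open>deg i\<close>. The function \<open>f\<close> stands
  for proportions when the drift is bounded and for draws when the increment is.\<close>

lemma neighbor_sum_bound:
  fixes z :: real
  assumes "\<And>j. j \<in> neighbors E i \<Longrightarrow> 0 \<le> f j \<and> f j \<le> (1::real)" "0 \<le> z" "z \<le> 1"
  shows "\<bar>(\<Sum>j\<in>neighbors E i. f j) - deg i * z\<bar> \<le> deg i"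
proof -
  have "0 \<le> (\<Sum>j\<in>neighbors E i. f j)"
    using assms(1) by (intro sum_nonneg) auto
  moreover have "(\<Sum>j\<in>neighbors E i. f j) \<le> deg i"
    using sum_mono[of "neighbors E i" f "\<lambda>_. 1"] assms(1) by simp
  moreover have "0 \<le> deg i * z" "deg i * z \<le> deg i"
    using assms(2,3) by (auto intro: mult_right_le_one_le)
  ultimately show ?thesis
    by linarith
qed

text \<open>Summing over ordered pairs of neighbors cancels the drift up to the discrepancy between
  \<open>deg i / (1 + deg i * (t + 1))\<close> and \<open>1 / (t + 1)\<close>.\<close>

lemma drift_bound: "\<bar>drift t w\<bar> \<le> total_deg / (real (Suc t))\<^sup>2"
proof -
  define T where "T = real (Suc t)"
  have T: "T > 0" by (simp add: T_def)
  define g where "g i = (\<Sum>j\<in>neighbors E i. Z j t w) - deg i * Z i t w" for i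
  have "(\<Sum>i\<in>V. \<Sum>j\<in>neighbors E i. Z j t w) = (\<Sum>i\<in>V. \<Sum>j\<in>{j \<in> V. j \<in> neighbors E i}. Z j t w)"
    by (intro sum.cong refl) (auto intro: neighbors_in_V)
  also have "\<dots> = (\<Sum>j\<in>V. \<Sum>i\<in>{i \<in> V. j \<in> neighbors E i}. Z j t w)"
    by (rule sum.swap_restrict) auto
  also have "\<dots> = (\<Sum>j\<in>V. \<Sum>i\<in>neighbors E j. Z j t w)"
  proof (rule sum.cong[OF refl])
    fix j
    have "{i \<in> V. j \<in> neighbors E i} = neighbors E j"
      using neighbors_sym[of j] neighbors_in_V by blast
    then show "(\<Sum>i\<in>{i \<in> V. j \<in> neighbors E i}. Z j t w) = (\<Sum>i\<in>neighbors E j. Z j t w)"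
      by simp
  qed
  finally have "(\<Sum>i\<in>V. g i) = 0"
    by (simp add: g_def sum_subtractf)
  then have "drift t w = (\<Sum>i\<in>V. deg i / (1 + deg i * T) * g i) - (\<Sum>i\<in>V. 1 / T * g i)"
    unfolding sum_distrib_left[symmetric] by (simp add: drift_def g_def T_def algebra_simps)
  also have "\<dots> = (\<Sum>i\<in>V. (deg i / (1 + deg i * T) - 1 / T) * g i)"
    by (simp add: sum_subtractf left_diff_distrib)
  also have "\<bar>\<dots>\<bar> \<le> (\<Sum>i\<in>V. deg i / T\<^sup>2)"
  proof (rule order_trans[OF sum_abs sum_mono])
    fix i assume "i \<in> V"
    then have d: "real (deg i) \<ge> 1"
      using deg_ge_1 by simp
    then have pos: "1 + deg i * T > 0"
      using T by (simp add: add_pos_pos)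
    have "deg i / (1 + deg i * T) - 1 / T = - (1 / (T * (1 + deg i * T)))"
      using T pos by (simp add: field_simps)
    \<comment> \<open>Here \<open>deg i\<close> being at least 1 matters: it makes the urn size
      \<open>1 + deg i * T\<close> at least \<open>T\<close>.\<close>
    moreover have "1 / (T * (1 + deg i * T)) \<le> 1 / T\<^sup>2"
    proof (rule divide_left_mono)
      have "1 * T \<le> deg i * T"
        using d T by (intro mult_right_mono) auto
      then have "T \<le> 1 + deg i * T"
        by linarith
      then show "T\<^sup>2 \<le> T * (1 + deg i * T)"
        using T by (simp add: power2_eq_square del: of_nat_Suc)
    qed (use T pos in auto)
    ultimately have "\<bar>deg i / (1 + deg i * T) - 1 / T\<bar> \<le> 1 / T\<^sup>2"
      using T pos by simp
    moreover have "\<bar>g i\<bar> \<le> deg i"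
      unfolding g_def by (rule neighbor_sum_bound) (auto simp: urn_prop_bounds)
    ultimately have "\<bar>deg i / (1 + deg i * T) - 1 / T\<bar> * \<bar>g i\<bar> \<le> 1 / T\<^sup>2 * deg i"
      by (intro mult_mono) auto
    then show "\<bar>(deg i / (1 + deg i * T) - 1 / T) * g i\<bar> \<le> deg i / T\<^sup>2"
      by (simp add: abs_mult)
  qed
  finally show ?thesis
    by (simp add: total_deg_def sum_divide_distrib T_def)
qed

text \<open>At most \<open>deg i\<close> new balls of either color enter an urn of new size
  \<open>1 + deg i * Suc t\<close>, so each proportion moves by at most
  \<open>1 / Suc t\<close>.\<close>

lemma increment_bound:
  assumes "w \<in> space M"
  shows "\<bar>weighted_prop (Suc t) w - weighted_prop t w\<bar> \<le> total_deg / Suc t"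
proof -
  have "weighted_prop (Suc t) w - weighted_prop t w = (\<Sum>i\<in>V. deg i * (Z i (Suc t) w - Z i t w))"
    by (simp add: weighted_prop_def sum_subtractf right_diff_distrib)
  also have "\<bar>\<dots>\<bar> \<le> (\<Sum>i\<in>V. deg i * (1 / Suc t))"
  proof (rule order_trans[OF sum_abs sum_mono])
    fix i assume "i \<in> V"
    have pos: "1 + real (deg i * Suc t) > 0"
      by (simp add: add_pos_nonneg)
    have "\<bar>(\<Sum>j\<in>neighbors E i. real (X j (Suc t) w)) - deg i * Z i t w\<bar> \<le> deg i"
    proof (rule neighbor_sum_bound)
      show "0 \<le> real (X j (Suc t) w) \<and> real (X j (Suc t) w) \<le> 1" if "j \<in> neighbors E i" for j
        using draw_le_1[OF neighbors_in_V[OF that] assms, of t] by simp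
    qed (simp_all add: urn_prop_bounds)
    then have "\<bar>Z i (Suc t) w - Z i t w\<bar> \<le> deg i / (1 + real (deg i * Suc t))"
      unfolding urn_prop_step[OF assms] abs_divide using pos
      by (simp add: divide_right_mono)
    also have "\<dots> \<le> 1 / Suc t"
      using pos by (simp add: divide_simps) (simp add: algebra_simps)
    finally show "\<bar>deg i * (Z i (Suc t) w - Z i t w)\<bar> \<le> deg i * (1 / Suc t)"
      by (simp only: abs_mult abs_of_nat mult_left_mono of_nat_0_le_iff)
  qed
  finally show ?thesis
    by (simp add: total_deg_def sum_divide_distrib)
qed

section \<open>Second moments of the weighted proportion on events of the past\<close>

text \<open>The noise terms of \<open>weighted_prop_step\<close> all integrate to zero against
  \<open>f\<close>.\<close>

lemma integral_mult_increment:
  fixes f :: "'a \<Rightarrow> real"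
  assumes f: "f \<in> borel_measurable (Hist t)"
    and bound: "\<And>w. w \<in> space M \<Longrightarrow> \<bar>f w\<bar> \<le> B"
    and int: "integrable M (\<lambda>w. f w * drift t w)"
  shows "(\<integral>w. f w * (weighted_prop (Suc t) w - weighted_prop t w) \<partial>M) = (\<integral>w. f w * drift t w \<partial>M)"
proof -
  let ?c = "\<lambda>i. deg i / (1 + deg i * Suc t)"
  let ?h = "\<lambda>i j w. ?c i * (f w * (real (X j (Suc t) w) - Z j t w))"
  have h: "integrable M (?h i j)" "(\<integral>w. ?h i j w \<partial>M) = 0" if "j \<in> neighbors E i" for i j
    using integral_mult_draw_diff[OF neighbors_in_V[OF that] f bound] by simp_all
  have "(\<integral>w. f w * (weighted_prop (Suc t) w - weighted_prop t w) \<partial>M)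
      = (\<integral>w. f w * drift t w + (\<Sum>i\<in>V. \<Sum>j\<in>neighbors E i. ?h i j w) \<partial>M)"
    by (rule Bochner_Integration.integral_cong[OF refl])
       (simp add: weighted_prop_step distrib_left sum_distrib_left mult_ac)
  also have "\<dots> = (\<integral>w. f w * drift t w \<partial>M) + (\<integral>w. (\<Sum>i\<in>V. \<Sum>j\<in>neighbors E i. ?h i j w) \<partial>M)"
    by (intro Bochner_Integration.integral_add int Bochner_Integration.integrable_sum h)
  also have "(\<integral>w. (\<Sum>i\<in>V. \<Sum>j\<in>neighbors E i. ?h i j w) \<partial>M) = (\<Sum>i\<in>V. \<Sum>j\<in>neighbors E i. (\<integral>w. ?h i j w \<partial>M))"
    by (subst Bochner_Integration.integral_sum)
       (rule Bochner_Integration.integrable_sum h sum.cong refl Bochner_Integration.integral_sum; assumption?)+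
  also have "\<dots> = 0"
    by (intro sum.neutral ballI h)
  finally show ?thesis
    by simp
qed

text \<open>With \<open>A\<close> the old deviation, \<open>I\<close> the increment,
  \<open>D\<close> the total degree and \<open>T = Suc t\<close>, expand the square of
  \<open>A + I\<close>. The cross term contributes at most \<open>2 * D^2 / T^2\<close> and the
  squared increment at most \<open>D^2 / T^2\<close>, which explains the factor 3. The range of
  \<open>q\<close> ensures that \<open>A\<close> is bounded by \<open>D\<close>.\<close>

lemma second_moment_step:
  assumes G: "G \<in> sets (Hist t)" and q: "0 \<le> q" "q \<le> total_deg"
  shows "(\<integral>w. indicator G w * (weighted_prop (Suc t) w - q)\<^sup>2 \<partial>M)
     \<le> (\<integral>w. indicator G w * (weighted_prop t w - q)\<^sup>2 \<partial>M) + prob G * (3 * total_deg\<^sup>2 / (Suc t)\<^sup>2)"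
proof -
  define T where "T = real (Suc t)"
  have T: "T \<ge> 1" by (simp add: T_def)
  define D where "D = total_deg"
  define A where "A w = weighted_prop t w - q" for w
  define I where "I w = weighted_prop (Suc t) w - weighted_prop t w" for w
  define f where "f w = indicator G w * (2 * A w)" for w :: 'a
  have [measurable]: "G \<in> sets M"
    using G subalgebra_urn_history[of t] by (auto simp: subalgebra_def)
  have [measurable]: "A \<in> borel_measurable M" "I \<in> borel_measurable M" "f \<in> borel_measurable M"
    unfolding A_def I_def f_def by measurable
  have fH: "f \<in> borel_measurable (Hist t)"
    unfolding f_def A_def
    by (intro borel_measurable_times borel_measurable_indicator borel_measurable_diff
          borel_measurable_const weighted_prop_history_measurable G)
  have D: "D \<ge> 0" unfolding D_def by (rule total_deg_nonneg)
  have A: "\<bar>A w\<bar> \<le> D" for w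
    using weighted_prop_bounds[of t w] q unfolding A_def D_def by linarith
  have I: "\<bar>I w\<bar> \<le> D / T" if "w \<in> space M" for w
    using increment_bound[OF that, of t] unfolding I_def D_def T_def by simp
  have dr: "\<bar>drift t w\<bar> \<le> D / T\<^sup>2" for w
    using drift_bound[of t w] unfolding D_def T_def .
  have f: "\<bar>f w\<bar> \<le> 2 * D" for w
    using A[of w] D by (auto simp: f_def indicator_def abs_mult)
  have fdr: "\<bar>f w * drift t w\<bar> \<le> 2 * D * (D / T\<^sup>2)" for w
    unfolding abs_mult using f[of w] dr[of w] D by (intro mult_mono) auto
  have fI: "\<bar>f w * I w\<bar> \<le> 2 * D * (D / T)" if "w \<in> space M" for w
    unfolding abs_mult using f[of w] I[OF that] D by (intro mult_mono) auto
  have I2: "(I w)\<^sup>2 \<le> D\<^sup>2 / T\<^sup>2" if "w \<in> space M" for w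
    using power_mono[OF I[OF that] abs_ge_zero, of 2] by (simp add: power_divide)
  have A2: "(A w)\<^sup>2 \<le> D\<^sup>2" for w
    using power_mono[OF A[of w] abs_ge_zero, of 2] by simp
  have int_fdr: "integrable M (\<lambda>w. f w * drift t w)"
    by (rule integrable_const_bound[OF AE_I2]) (use fdr in auto)
  have int_fI: "integrable M (\<lambda>w. f w * I w)"
    by (rule integrable_const_bound[OF AE_I2]) (use fI in auto)
  have int_I: "integrable M (\<lambda>w. indicator G w * (I w)\<^sup>2)"
    by (rule integrable_const_bound[OF AE_I2, of _ "D\<^sup>2 / T\<^sup>2"])
       (use I2 in \<open>auto simp: indicator_def\<close>)
  have int_A: "integrable M (\<lambda>w. indicator G w * (A w)\<^sup>2)"
    by (rule integrable_const_bound[OF AE_I2, of _ "D\<^sup>2"])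
       (use A2 in \<open>auto simp: indicator_def\<close>)
  have "(\<integral>w. indicator G w * (weighted_prop (Suc t) w - q)\<^sup>2 \<partial>M)
      = (\<integral>w. indicator G w * (A w)\<^sup>2 + f w * I w + indicator G w * (I w)\<^sup>2 \<partial>M)"
  proof (rule Bochner_Integration.integral_cong[OF refl])
    fix w
    have "weighted_prop (Suc t) w - q = A w + I w"
      by (simp add: A_def I_def)
    then show "indicator G w * (weighted_prop (Suc t) w - q)\<^sup>2
        = indicator G w * (A w)\<^sup>2 + f w * I w + indicator G w * (I w)\<^sup>2"
      by (simp add: f_def power2_sum distrib_left)
  qed
  also have "\<dots> = (\<integral>w. indicator G w * (A w)\<^sup>2 \<partial>M) + (\<integral>w. f w * I w \<partial>M) + (\<integral>w. indicator G w * (I w)\<^sup>2 \<partial>M)"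
    using int_A int_fI int_I by simp
  \<comment> \<open>The pointwise bound \<open>fI\<close> is only of order \<open>1 / T\<close>,
    which is not summable. As \<open>f\<close> depends on the past alone, the increment may be
    replaced by its drift, of order \<open>1 / T^2\<close>.\<close>
  also have "(\<integral>w. f w * I w \<partial>M) = (\<integral>w. f w * drift t w \<partial>M)"
    unfolding I_def by (rule integral_mult_increment[OF fH f int_fdr])
  also have "\<dots> \<le> (\<integral>w. indicator G w * (2 * D * (D / T\<^sup>2)) \<partial>M)"
  proof (rule integral_mono[OF int_fdr])
    show "f w * drift t w \<le> indicator G w * (2 * D * (D / T\<^sup>2))" for w
      using fdr[of w] by (cases "w \<in> G") (auto simp: f_def)
  qed (auto intro!: integrable_mult_left integrable_real_indicator simp: emeasure_eq_measure)
  also have "(\<integral>w. indicator G w * (I w)\<^sup>2 \<partial>M) \<le> (\<integral>w. indicator G w * (D\<^sup>2 / T\<^sup>2) \<partial>M)"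
  proof (rule integral_mono[OF int_I])
    show "indicator G w * (I w)\<^sup>2 \<le> indicator G w * (D\<^sup>2 / T\<^sup>2)" if "w \<in> space M" for w
      using I2[OF that] by (intro mult_left_mono) auto
  qed (auto intro!: integrable_mult_left integrable_real_indicator simp: emeasure_eq_measure)
  finally have "(\<integral>w. indicator G w * (weighted_prop (Suc t) w - q)\<^sup>2 \<partial>M)
     \<le> (\<integral>w. indicator G w * (A w)\<^sup>2 \<partial>M) + prob G * (2 * D * (D / T\<^sup>2)) + prob G * (D\<^sup>2 / T\<^sup>2)"
    by simp
  also have "prob G * (2 * D * (D / T\<^sup>2)) = prob G * (2 * (D\<^sup>2 / T\<^sup>2))"
    by (simp add: power2_eq_square)
  finally show ?thesis
    by (simp add: A_def D_def T_def mult_ac)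
qed

text \<open>The one-step errors telescope, because \<open>1 / (t + 1)^2\<close> is at most
  \<open>1 / t - 1 / (t + 1)\<close>. A start at \<open>1 <= s\<close> keeps the fractions away from
  the value 0 of \<open>1 / 0\<close>.\<close>

lemma second_moment_bound:
  assumes G: "G \<in> sets (Hist s)" and q: "0 \<le> q" "q \<le> total_deg" and "1 \<le> s" "s \<le> t"
  shows "(\<integral>w. indicator G w * (weighted_prop t w - q)\<^sup>2 \<partial>M)
     \<le> (\<integral>w. indicator G w * (weighted_prop s w - q)\<^sup>2 \<partial>M) + prob G * (3 * total_deg\<^sup>2 * (1 / s - 1 / t))"
  using \<open>s \<le> t\<close>
proof (induction t rule: dec_induct)
  case (step t)
  have "G \<in> sets (Hist t)"
    using G urn_history_mono[OF step.hyps(1)] by blast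
  note second_moment_step[OF this q]
  also note step.IH
  also have "prob G * (3 * total_deg\<^sup>2 / (Suc t)\<^sup>2) \<le> prob G * (3 * total_deg\<^sup>2 * (1 / t - 1 / Suc t))"
  proof (intro mult_left_mono)
    have "t > 0" using step.hyps \<open>1 \<le> s\<close> by simp
    then have "1 / (real (Suc t))\<^sup>2 \<le> 1 / t - 1 / Suc t"
      by (simp add: divide_simps power2_eq_square)
    then have "3 * total_deg\<^sup>2 * (1 / (real (Suc t))\<^sup>2) \<le> 3 * total_deg\<^sup>2 * (1 / t - 1 / Suc t)"
      by (intro mult_left_mono) auto
    then show "3 * total_deg\<^sup>2 / (Suc t)\<^sup>2 \<le> 3 * total_deg\<^sup>2 * (1 / t - 1 / Suc t)"
      by simp
  qed simp
  finally show ?case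
    by (simp add: algebra_simps)
qed simp

section \<open>Prescribed signals and draws of positive probability\<close>

text \<open>The indicator of a maximal independent set does the job.\<close>

lemma exists_mixing_signals:
  "\<exists>c :: 'v \<Rightarrow> bool. \<forall>i\<in>V. \<exists>j\<in>neighbors E i. c j \<noteq> c i"
proof -
  define S where "S = {I. I \<subseteq> V \<and> (\<forall>i\<in>I. \<forall>j\<in>I. j \<notin> neighbors E i)}"
  have "finite S"
    by (rule finite_subset[of _ "Pow V"]) (auto simp: S_def)
  moreover have "{} \<in> S"
    by (simp add: S_def)
  ultimately obtain I where I: "I \<in> S" and max: "\<And>J. J \<in> S \<Longrightarrow> I \<subseteq> J \<Longrightarrow> I = J"
    using finite_has_maximal[of S] by blast
  have "\<exists>j\<in>neighbors E i. (j \<in> I) \<noteq> (i \<in> I)" if "i \<in> V" for i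
  proof (cases "i \<in> I")
    case True
    obtain j where "j \<in> neighbors E i"
      using no_isolated[OF \<open>i \<in> V\<close>] by blast
    moreover have "j \<notin> I"
      using calculation True I by (auto simp: S_def)
    ultimately show ?thesis
      using True by blast
  next
    case False
    then have "insert i I \<notin> S"
      using max[of "insert i I"] by auto
    \<comment> \<open>A pair violating independence of \<open>insert i I\<close> must contain
      \<open>i\<close>, and its other member lies in \<open>I\<close> because there are no
      loops.\<close>
    then have "\<exists>j\<in>I. j \<in> neighbors E i \<or> i \<in> neighbors E j"
      using I \<open>i \<in> V\<close> not_self_neighbor[of i] by (auto simp: S_def)
    then obtain j where "j \<in> I" "j \<in> neighbors E i"
      using neighbors_sym[of i] by auto
    then show ?thesis
      using False by blast
  qed
  then show ?thesis
    by (intro exI[of _ "\<lambda>i. i \<in> I"] ballI)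
qed

text \<open>A cylinder set of the process: all urn contents up to time \<open>t\<close> are constant
  on it.\<close>

definition path_event :: "('v \<Rightarrow> bool) \<Rightarrow> (nat \<Rightarrow> 'v \<Rightarrow> nat) \<Rightarrow> nat \<Rightarrow> 'a set" where
  "path_event c x t = {w \<in> space M. (\<forall>i\<in>V. C i w = c i) \<and> (\<forall>k\<in>{1..t}. \<forall>i\<in>V. X i k w = x k i)}"

lemma path_event_Suc:
  "path_event c x (Suc t) = path_event c x t \<inter> {w \<in> space M. \<forall>i\<in>V. X i (Suc t) w = x (Suc t) i}"
  by (auto simp: path_event_def atLeastAtMostSuc_conv)

lemma path_event_history: "path_event c x t \<in> sets (Hist t)"
proof -
  have "{w \<in> space (Hist t). X i k w = x k i} \<in> sets (Hist t)" if "k \<in> {1..t}" "i \<in> V" for i k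
  proof -
    have "X i k -` {x k i} \<inter> space (Hist t) \<in> sets (Hist t)"
      by (rule measurable_sets[OF draw_history_measurable]) (use that in auto)
    also have "X i k -` {x k i} \<inter> space (Hist t) = {w \<in> space (Hist t). X i k w = x k i}"
      by auto
    finally show ?thesis .
  qed
  then have "{w \<in> space (Hist t). (\<forall>i\<in>V. C i w = c i) \<and> (\<forall>k\<in>{1..t}. \<forall>i\<in>V. X i k w = x k i)}
      \<in> sets (Hist t)"
    by (intro sets.sets_Collect_conj sets.sets_Collect_finite_All finite_V finite_atLeastAtMost)
       (simp_all add: signal_history_measurable)
  then show ?thesis
    by (simp add: path_event_def)
qed

lemma path_event_sets [measurable]: "path_event c x t \<in> sets M"
  using path_event_history[of c x t] subalgebra_urn_history[of t] by (auto simp: subalgebra_def)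

text \<open>Independence of the signals turns the probability into a product of factors \<alpha> and
  1 - \<alpha>. The empty vertex set is separate since the product formula asks for a nonempty index
  set.\<close>

lemma path_event_0_pos:
  assumes "0 < \<alpha>" "\<alpha> < 1"
  shows "prob (path_event c x 0) > 0"
proof (cases "V = {}")
  case True
  then show ?thesis
    unfolding path_event_def by (simp add: prob_space)
next
  case False
  have [measurable]: "Measurable.pred M (C i)" if "i \<in> V" for i
    using signal_random_variable[OF that] by simp
  have "prob (C i -` {c i} \<inter> space M) > 0" if "i \<in> V" for i
  proof (cases "c i")
    case True
    then have "C i -` {c i} \<inter> space M = {w \<in> space M. C i w}"
      by auto
    then show ?thesis
      using signals_prob[OF that] assms by simp
  next
    case False
    then have "C i -` {c i} \<inter> space M = space M - {w \<in> space M. C i w}"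
      by auto
    moreover have "prob (space M - {w \<in> space M. C i w}) = 1 - \<alpha>"
      by (subst prob_compl) (use that signals_prob[OF that] in auto)
    ultimately show ?thesis
      using assms by simp
  qed
  then have "(\<Prod>i\<in>V. prob (C i -` {c i} \<inter> space M)) > 0"
    by (intro prod_pos) auto
  also have "(\<Prod>i\<in>V. prob (C i -` {c i} \<inter> space M)) = prob (\<Inter>i\<in>V. C i -` {c i} \<inter> space M)"
    by (rule indep_varsD[OF signals_indep False, symmetric]) auto
  also have "(\<Inter>i\<in>V. C i -` {c i} \<inter> space M) = path_event c x 0"
    using False by (auto simp: path_event_def)
  finally show ?thesis .
qed

text \<open>By conditional independence, the prescribed next draws have conditional probability
  \<open>g\<close>, a product of factors \<open>Z i t\<close> or \<open>1 - Z i t\<close>. It is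
  positive on the path event, so its integral over this event of positive probability is
  positive.\<close>

lemma path_event_Suc_pos:
  assumes pos: "prob (path_event c x t) > 0"
    and bin: "\<And>i. i \<in> V \<Longrightarrow> x (Suc t) i \<in> {0, 1}"
    and Z: "\<And>w i. w \<in> path_event c x t \<Longrightarrow> i \<in> V \<Longrightarrow>
              (if x (Suc t) i = 1 then 0 < Z i t w else Z i t w < 1)"
  shows "prob (path_event c x (Suc t)) > 0"
proof (cases "V = {}")
  case True
  then show ?thesis
    using pos unfolding path_event_def by simp
next
  case False
  let ?G = "path_event c x t"
  define A where "A = {w \<in> space M. \<forall>i\<in>V. X i (Suc t) w = x (Suc t) i}"
  define g where "g w = (\<Prod>i\<in>V. if x (Suc t) i = 1 then Z i t w else 1 - Z i t w)" for w
  have [measurable]: "X i (Suc t) \<in> measurable M (count_space UNIV)" if "i \<in> V" for i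
    by (rule draw_random_variable_UNIV[OF that])
  have [measurable]: "A \<in> sets M"
    unfolding A_def by measurable
  have "AE w in M. prob_given M (Hist t) {w\<in>space M. \<forall>i\<in>V. X i (Suc t) w \<in> {x (Suc t) i}} w
      = (\<Prod>i\<in>V. prob_given M (Hist t) {w\<in>space M. X i (Suc t) w \<in> {x (Suc t) i}} w)"
    using draws_cond_indep[of t] bin False unfolding cond_indep_vars_def
    by (elim conjE allE[of _ V] impE ballE[of _ _ "\<lambda>i. {x (Suc t) i}"]) auto
  moreover have "AE w in M. \<forall>i\<in>V. prob_given M (Hist t) {w\<in>space M. X i (Suc t) w = x (Suc t) i} w
      = (if x (Suc t) i = 1 then Z i t w else 1 - Z i t w)"
    by (intro AE_finite_allI finite_V prob_given_draw bin)
  ultimately have cond: "AE w in M. real_cond_exp M (Hist t) (indicator A) w = g w"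
    unfolding A_def g_def prob_given_def by eventually_elim simp
  have int: "integrable M (\<lambda>w. indicator ?G w * (indicator A w :: real))"
    by (rule integrable_const_bound[of _ 1]) (auto simp: indicator_def)
  have GH: "(indicator ?G :: 'a \<Rightarrow> real) \<in> borel_measurable (Hist t)"
    by (rule borel_measurable_indicator[OF path_event_history])
  have g_bounds: "0 \<le> g w" "g w \<le> 1" for w
    unfolding g_def by (auto intro!: prod_nonneg prod_le_1 simp: urn_prop_bounds)
  have [measurable]: "g \<in> borel_measurable M"
    unfolding g_def by measurable
  have int_g: "integrable M (\<lambda>w. indicator ?G w * g w)"
    by (rule integrable_const_bound[of _ 1]) (auto simp: indicator_def g_bounds)
  have "prob (path_event c x (Suc t)) = (\<integral>w. indicator (?G \<inter> A) w \<partial>M)"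
    by (simp add: path_event_Suc A_def)
  also have "\<dots> = (\<integral>w. indicator ?G w * indicator A w \<partial>M)"
    by (simp add: indicator_inter_arith)
  also have "\<dots> = (\<integral>w. indicator ?G w * real_cond_exp M (Hist t) (indicator A) w \<partial>M)"
    by (rule hist.real_cond_exp_intg(2)[OF int GH, symmetric]) measurable
  also have "\<dots> = (\<integral>w. indicator ?G w * g w \<partial>M)"
    using cond by (intro integral_cong_AE) auto
  finally have eq: "prob (path_event c x (Suc t)) = (\<integral>w. indicator ?G w * g w \<partial>M)" .
  have "(\<integral>w. indicator ?G w * g w \<partial>M) \<noteq> 0"
  proof
    assume "(\<integral>w. indicator ?G w * g w \<partial>M) = 0"
    then have zero: "AE w in M. indicator ?G w * g w = 0"
      using integral_nonneg_eq_0_iff_AE[OF int_g] g_bounds by auto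
    have "g w > 0" if "w \<in> ?G" for w
      unfolding g_def by (intro prod_pos) (use Z[OF that] in \<open>force split: if_splits\<close>)
    then have "indicator ?G w * g w = 0 \<Longrightarrow> w \<notin> ?G" for w
      by (force simp: indicator_def split: if_splits)
    then have "AE w in M. w \<notin> ?G"
      by (rule eventually_mono[OF zero])
    then have "prob ?G = 0"
      using prob_eq_0[of ?G] by simp
    with pos show False
      by simp
  qed
  then show ?thesis
    using eq measure_nonneg[of M "path_event c x (Suc t)"] by linarith
qed

text \<open>Balls are never removed, so an urn holding both colors after the first step holds both
  forever.\<close>

lemma mixed_urn_prop:
  assumes w: "w \<in> space M" and "1 \<le> t"
    and "0 < urn_black E C X i 1 w" "0 < urn_white E C X i 1 w"
  shows "0 < Z i t w" "Z i t w < 1"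
proof -
  have "0 < urn_black E C X i t w \<and> 0 < urn_white E C X i t w"
    using \<open>1 \<le> t\<close>
  proof (induction t rule: dec_induct)
    case (step t)
    then show ?case
      using draw_sum_le[OF w, of t i] by simp
  qed (use assms in simp)
  then show "0 < Z i t w" "Z i t w < 1"
    by (simp_all add: urn_prop_def urn_total_def)
qed

text \<open>In the first step every agent draws his initial ball, which mixes all urns for suitable
  signals; afterwards any sequence of draws is possible, for instance \<open>\<lfloor>p * n\<rfloor>\<close> steps in
  which all draws are black followed by steps in which all draws are white.\<close>

lemma history_event_near:
  assumes \<alpha>: "0 < \<alpha>" "\<alpha> < 1" and p: "0 \<le> p" "p \<le> 1"
  obtains G where "G \<in> sets (Hist (Suc n))" "prob G > 0"
    "\<And>w i. w \<in> G \<Longrightarrow> i \<in> V \<Longrightarrow> \<bar>Z i (Suc n) w - p\<bar> \<le> 3 / Suc n"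
proof -
  obtain c :: "'v \<Rightarrow> bool" where c: "\<And>i. i \<in> V \<Longrightarrow> \<exists>j\<in>neighbors E i. c j \<noteq> c i"
    using exists_mixing_signals by blast
  define b where "b = nat \<lfloor>p * n\<rfloor>"
  \<comment> \<open>A correct signal \<open>c i\<close> means a white initial ball, hence the draw 0
    in step 1. Steps 2 to \<open>Suc b\<close> are black for all agents, later ones white.\<close>
  define x where "x k i = (if k = 1 then if c i then 0 else 1 else if k \<le> Suc b then 1 else 0 :: nat)" for k i
  have pn: "0 \<le> p * n" "p * n \<le> n"
    using p by (auto intro: mult_left_le_one_le)
  then have b: "real b \<le> p * n" "p * n \<le> real b + 1"
    unfolding b_def by linarith+
  then have "b \<le> n"
    using pn(2) by linarith
  \<comment> \<open>The count of white balls is given through a sum, which avoids truncated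
    subtraction.\<close>
  have black1: "urn_black E C X i 1 w = (if c i then 0 else 1) + (\<Sum>j\<in>neighbors E i. if c j then 0 else 1)"
    and white1: "urn_white E C X i 1 w + (\<Sum>j\<in>neighbors E i. if c j then 0 else 1) = (if c i then 1 else 0) + deg i"
    if "w \<in> path_event c x t" "1 \<le> t" "i \<in> V" for w t i
  proof -
    have w: "w \<in> space M"
      using that by (simp add: path_event_def)
    have "(\<Sum>j\<in>neighbors E i. X j (Suc 0) w) = (\<Sum>j\<in>neighbors E i. if c j then 0 else 1)"
      using that neighbors_in_V by (intro sum.cong refl) (auto simp: path_event_def x_def)
    moreover have "C i w = c i"
      using that by (simp add: path_event_def)
    ultimately show "urn_black E C X i 1 w = (if c i then 0 else 1) + (\<Sum>j\<in>neighbors E i. if c j then 0 else 1)"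
      "urn_white E C X i 1 w + (\<Sum>j\<in>neighbors E i. if c j then 0 else 1) = (if c i then 1 else 0) + deg i"
      using draw_sum_le[OF w, of 0 i] by simp_all
  qed
  have sum_le: "(\<Sum>j\<in>neighbors E i. if c j then 0 else 1 :: nat) \<le> deg i" for i
  proof -
    have "(\<Sum>j\<in>neighbors E i. if c j then 0 else 1 :: nat) \<le> (\<Sum>j\<in>neighbors E i. 1)"
      by (intro sum_mono) auto
    then show ?thesis
      by simp
  qed
  have mixed: "0 < urn_black E C X i 1 w \<and> 0 < urn_white E C X i 1 w"
    if wt: "w \<in> path_event c x t" "1 \<le> t" and i: "i \<in> V" for w t i
  proof -
    \<comment> \<open>The urn keeps its own initial ball, and the neighbor \<open>j\<close> with the
      opposite signal adds a ball of the other color.\<close>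
    obtain j where j: "j \<in> neighbors E i" "c j \<noteq> c i"
      using c[OF i] by blast
    show ?thesis
    proof (cases "c i")
      case True
      then have "(\<Sum>j\<in>neighbors E i. if c j then 0 else 1) > (0::nat)"
        using j by (intro sum_pos2[of _ j]) auto
      then show ?thesis
        using sum_le[of i] black1[OF wt i] white1[OF wt i] True by simp
    next
      case False
      then have "(\<Sum>j\<in>neighbors E i. if c j then 0 else 1) < (\<Sum>j\<in>neighbors E i. 1::nat)"
        using j by (intro sum_strict_mono_ex1) auto
      then show ?thesis
        using black1[OF wt i] white1[OF wt i] False by simp
    qed
  qed
  have pos: "prob (path_event c x t) > 0" for t
  proof (induction t)
    case 0
    show ?case
      by (rule path_event_0_pos[OF \<alpha>])
  next
    case (Suc t)
    show ?case
    proof (rule path_event_Suc_pos[OF Suc.IH])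
      fix w i assume w: "w \<in> path_event c x t" and i: "i \<in> V"
      show "if x (Suc t) i = 1 then 0 < Z i t w else Z i t w < 1"
      \<comment> \<open>At time 0 the single ball has the prescribed color, so the required draw is
        certain. From time 1 on the urn is mixed and both draws are possible.\<close>
      proof (cases "t = 0")
        case True
        then show ?thesis
          using w i by (auto simp: x_def path_event_def urn_prop_eq)
      next
        case False
        then show ?thesis
          using mixed_urn_prop[of w t i] mixed[OF w _ i] w by (auto simp: path_event_def)
      qed
    qed (auto simp: x_def)
  qed
  \<comment> \<open>Here \<open>m\<close> counts the steps after the first; \<open>min b m\<close>
    of them are black.\<close>
  have black: "urn_black E C X i (Suc m) w = urn_black E C X i 1 w + deg i * min b m"
    if "w \<in> path_event c x (Suc n)" "m \<le> n" for w i m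
    using that(2)
  proof (induction m)
    case (Suc m)
    have "(\<Sum>j\<in>neighbors E i. X j (Suc (Suc m)) w) = (\<Sum>j\<in>neighbors E i. if m < b then 1 else 0)"
      using that(1) Suc.prems neighbors_in_V
      by (intro sum.cong refl) (auto simp: path_event_def x_def)
    also have "\<dots> = deg i * (if m < b then 1 else 0)"
      by simp
    finally have "urn_black E C X i (Suc (Suc m)) w
        = urn_black E C X i (Suc m) w + deg i * (if m < b then 1 else 0)"
      by simp
    moreover have "min b (Suc m) = min b m + (if m < b then 1 else 0)"
      by auto
    ultimately show ?case
      using Suc by (simp add: distrib_left del: urn_black.simps)
  qed simp
  show ?thesis
  proof (rule that[OF path_event_history pos])
    fix w i assume w: "w \<in> path_event c x (Suc n)" and i: "i \<in> V"
    define d where "d = real (deg i)"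
    define B where "B = real (urn_black E C X i 1 w)"
    have d: "d \<ge> 1"
      using deg_ge_1[OF i] by (simp add: d_def)
    have "urn_black E C X i 1 w \<le> 1 + deg i"
      using sum_le[of i] black1[OF w _ i] by (simp del: urn_black.simps)
    then have B: "0 \<le> B" "B \<le> 1 + d"
      unfolding B_def d_def by linarith+
    have "w \<in> space M"
      using w by (simp add: path_event_def)
    then have Z: "Z i (Suc n) w = (B + d * b) / (1 + d * Suc n)"
      using black[OF w order_refl] \<open>b \<le> n\<close>
      by (simp add: urn_prop_eq B_def d_def algebra_simps del: urn_black.simps)
    have "d * b \<le> d * (p * n)" "d * (p * n) \<le> d * (real b + 1)"
      using b d by (auto intro: mult_left_mono)
    moreover have "p * (1 + d) \<le> 1 + d" "0 \<le> p * (1 + d)"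
      using p d by (auto intro: mult_left_le_one_le)
    moreover have "p * (1 + d * Suc n) = p * (1 + d) + d * (p * n)"
      by (simp add: algebra_simps)
    moreover have "d * (real b + 1) = d * b + d"
      by (simp add: algebra_simps)
    \<comment> \<open>The balls present after step 1, compared with \<open>p * (1 + d)\<close>, cost
      at most \<open>1 + d\<close>; rounding \<open>p * n\<close> down to \<open>b\<close> costs at
      most \<open>d\<close>. Since \<open>1 <= d\<close>, the sum is at most
      \<open>3 * d\<close>.\<close>
    ultimately have "\<bar>B + d * b - p * (1 + d * Suc n)\<bar> \<le> 3 * d"
      using B d by linarith
    moreover have pos: "0 < d * Suc n" "0 < 1 + d * Suc n"
      using d by (auto intro: add_pos_pos)
    moreover have "Z i (Suc n) w - p = (B + d * b - p * (1 + d * Suc n)) / (1 + d * Suc n)"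
      unfolding Z using pos by (simp add: field_simps del: of_nat_Suc)
    ultimately have "\<bar>Z i (Suc n) w - p\<bar> \<le> 3 * d / (1 + d * Suc n)"
      by (simp add: divide_right_mono)
    also have "\<dots> \<le> 3 * d / (d * Suc n)"
      using pos d by (intro divide_left_mono mult_pos_pos) auto
    also have "\<dots> = 3 / Suc n"
      using d by simp
    finally show "\<bar>Z i (Suc n) w - p\<bar> \<le> 3 / Suc n" .
  qed
qed

section \<open>Full support and non-degeneracy of the limit law\<close>

text \<open>If the limit were almost surely at distance at least \<epsilon> from \<open>p\<close>,
  its weighted square deviation on \<open>G\<close> would be at least \<open>prob G * D^2\<close>
  times the square of \<epsilon>. The moment bounds give at most
  \<open>prob G * 12 * D^2 / s\<close>, which is smaller for large \<open>s\<close>.\<close>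

lemma limit_near_pos:
  fixes Zbar :: "'a \<Rightarrow> real"
  assumes \<alpha>: "0 < \<alpha>" "\<alpha> < 1" and "V \<noteq> {}"
    and [measurable]: "Zbar \<in> borel_measurable M"
    and lim: "\<And>i. i \<in> V \<Longrightarrow> AE w in M. (\<lambda>t. Z i t w) \<longlonglongrightarrow> Zbar w"
    and p: "0 \<le> p" "p \<le> 1" and "0 < \<epsilon>"
  shows "prob {w \<in> space M. \<bar>Zbar w - p\<bar> < \<epsilon>} > 0"
proof (rule ccontr)
  assume "\<not> prob {w \<in> space M. \<bar>Zbar w - p\<bar> < \<epsilon>} > 0"
  then have "prob {w \<in> space M. \<bar>Zbar w - p\<bar> < \<epsilon>} = 0"
    using measure_nonneg[of M] by (metis order_le_less)
  then have far: "AE w in M. \<epsilon> \<le> \<bar>Zbar w - p\<bar>"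
    by (subst (asm) prob_eq_0) (auto elim: eventually_mono)
  define D where "D = total_deg"
  \<comment> \<open>The constant 12 is 9 + 3: the deviation at time \<open>s\<close> is at most
    \<open>3 * D / s\<close>, whose square is at most \<open>9 * D^2 / s\<close>, and the later
    fluctuations add at most \<open>3 * D^2 / s\<close>.\<close>
  obtain n where n: "12 / \<epsilon>\<^sup>2 < Suc n"
    using reals_Archimedean2[of "12 / \<epsilon>\<^sup>2"] less_Suc_eq by (metis of_nat_less_iff order_less_trans lessI)
  define s where "s = Suc n"
  have s: "1 \<le> real s" by (simp add: s_def)
  obtain G where GH: "G \<in> sets (Hist s)" and Gpos: "prob G > 0"
    and near: "\<And>w i. w \<in> G \<Longrightarrow> i \<in> V \<Longrightarrow> \<bar>Z i s w - p\<bar> \<le> 3 / s"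
    using history_event_near[OF \<alpha> p] unfolding s_def by metis
  have [measurable]: "G \<in> sets M"
    using GH subalgebra_urn_history[of s] by (auto simp: subalgebra_def)
  have "D > 0"
    unfolding D_def total_deg_def using \<open>V \<noteq> {}\<close> deg_ge_1 by (intro sum_pos) force+
  then have q: "0 \<le> D * p" "D * p \<le> D"
    using p by (auto intro: mult_right_le_one_le)
  have bound: "\<bar>weighted_prop t w - D * p\<bar> \<le> D" for t w
    using weighted_prop_bounds[of t w] q unfolding D_def by linarith
  have bound2: "(weighted_prop t w - D * p)\<^sup>2 \<le> D\<^sup>2" for t w
    using power_mono[OF bound[of t w] abs_ge_zero, of 2] by simp
  have intc: "integrable M (\<lambda>w. indicator G w * (r::real))" for r
    by (auto intro!: integrable_mult_left integrable_real_indicator simp: emeasure_eq_measure)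
  have intQ: "integrable M (\<lambda>w. indicator G w * (weighted_prop t w - D * p)\<^sup>2)" for t
    by (rule integrable_const_bound[OF AE_I2, of _ "D\<^sup>2"]) (use bound2 in \<open>auto simp: indicator_def\<close>)
  have "(\<integral>w. indicator G w * (weighted_prop s w - D * p)\<^sup>2 \<partial>M) \<le> (\<integral>w. indicator G w * (9 * D\<^sup>2 / s) \<partial>M)"
  proof (rule integral_mono[OF intQ intc])
    fix w
    show "indicator G w * (weighted_prop s w - D * p)\<^sup>2 \<le> indicator G w * (9 * D\<^sup>2 / s)"
    proof (cases "w \<in> G")
      case True
      have "weighted_prop s w - D * p = (\<Sum>i\<in>V. deg i * (Z i s w - p))"
        by (simp add: weighted_prop_def D_def total_deg_def sum_distrib_right sum_subtractf right_diff_distrib)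
      also have "\<bar>\<dots>\<bar> \<le> (\<Sum>i\<in>V. deg i * (3 / s))"
        using near[OF True]
        by (intro order_trans[OF sum_abs sum_mono]) (simp only: abs_mult abs_of_nat mult_left_mono of_nat_0_le_iff)
      also have "\<dots> = D * (3 / s)"
        by (simp add: D_def total_deg_def sum_distrib_right sum_divide_distrib)
      finally have "(weighted_prop s w - D * p)\<^sup>2 \<le> (D * (3 / s))\<^sup>2"
        using power_mono[OF _ abs_ge_zero, of "weighted_prop s w - D * p" _ 2] by simp
      also have "\<dots> = 9 * D\<^sup>2 / (real s * real s)"
        by (simp add: power2_eq_square)
      also have "\<dots> \<le> 9 * D\<^sup>2 / s"
        using s by (intro divide_left_mono) auto
      finally show ?thesis
        using True by simp
    qed simp
  qed
  then have start: "(\<integral>w. indicator G w * (weighted_prop s w - D * p)\<^sup>2 \<partial>M) \<le> prob G * (9 * D\<^sup>2 / s)"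
    by simp
  have upper: "(\<integral>w. indicator G w * (weighted_prop t w - D * p)\<^sup>2 \<partial>M) \<le> prob G * (12 * D\<^sup>2 / s)"
    if "s \<le> t" for t
  proof -
    have "(\<integral>w. indicator G w * (weighted_prop t w - D * p)\<^sup>2 \<partial>M)
        \<le> prob G * (9 * D\<^sup>2 / s) + prob G * (3 * D\<^sup>2 * (1 / s - 1 / t))"
      using second_moment_bound[OF GH, of "D * p" t] q that s start by (simp add: D_def)
    also have "\<dots> \<le> prob G * (9 * D\<^sup>2 / s) + prob G * (3 * D\<^sup>2 * (1 / s))"
      by (intro add_left_mono mult_left_mono) auto
    also have "\<dots> = prob G * (12 * D\<^sup>2 / s)"
      by (simp add: field_simps)
    finally show ?thesis .
  qed
  have "AE w in M. \<forall>i\<in>V. (\<lambda>t. Z i t w) \<longlonglongrightarrow> Zbar w"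
    by (intro AE_finite_allI finite_V lim)
  then have conv: "AE w in M. (\<lambda>t. indicator G w * (weighted_prop t w - D * p)\<^sup>2)
      \<longlonglongrightarrow> indicator G w * (D * Zbar w - D * p)\<^sup>2"
  proof eventually_elim
    case (elim w)
    then have "(\<lambda>t. weighted_prop t w) \<longlonglongrightarrow> (\<Sum>i\<in>V. deg i * Zbar w)"
      unfolding weighted_prop_def by (intro tendsto_sum tendsto_mult tendsto_const) auto
    then have "(\<lambda>t. weighted_prop t w) \<longlonglongrightarrow> D * Zbar w"
      by (simp add: D_def total_deg_def sum_distrib_right)
    then show ?case
      by (intro tendsto_intros)
  qed
  have dom: "AE w in M. norm (indicator G w * (weighted_prop t w - D * p)\<^sup>2) \<le> D\<^sup>2" for t
    using bound2 by (auto simp: indicator_def)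
  have int_lim: "integrable M (\<lambda>w. indicator G w * (D * Zbar w - D * p)\<^sup>2)"
    by (rule integrable_dominated_convergence[OF _ _ _ conv dom]) auto
  \<comment> \<open>Dominated convergence carries \<open>upper\<close>, which is uniform in
    \<open>t\<close>, over to the limit.\<close>
  have "(\<lambda>t. \<integral>w. indicator G w * (weighted_prop t w - D * p)\<^sup>2 \<partial>M)
      \<longlonglongrightarrow> (\<integral>w. indicator G w * (D * Zbar w - D * p)\<^sup>2 \<partial>M)"
    by (rule integral_dominated_convergence[OF _ _ _ conv dom]) auto
  then have "(\<integral>w. indicator G w * (D * Zbar w - D * p)\<^sup>2 \<partial>M) \<le> prob G * (12 * D\<^sup>2 / s)"
    by (rule LIMSEQ_le_const2) (use upper in blast)
  moreover have "(\<integral>w. indicator G w * (D\<^sup>2 * \<epsilon>\<^sup>2) \<partial>M) \<le> (\<integral>w. indicator G w * (D * Zbar w - D * p)\<^sup>2 \<partial>M)"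
  proof (rule integral_mono_AE[OF intc int_lim])
    show "AE w in M. indicator G w * (D\<^sup>2 * \<epsilon>\<^sup>2) \<le> indicator G w * (D * Zbar w - D * p)\<^sup>2"
      using far
    proof eventually_elim
      case (elim w)
      then have "\<epsilon>\<^sup>2 \<le> (Zbar w - p)\<^sup>2"
        using power_mono[OF elim, of 2] \<open>0 < \<epsilon>\<close> by simp
      then have "D\<^sup>2 * \<epsilon>\<^sup>2 \<le> D\<^sup>2 * (Zbar w - p)\<^sup>2"
        by (intro mult_left_mono) auto
      then show ?case
        by (intro mult_left_mono) (simp_all add: power_mult_distrib flip: right_diff_distrib)
    qed
  qed
  ultimately have "prob G * (D\<^sup>2 * \<epsilon>\<^sup>2) \<le> prob G * (12 * D\<^sup>2 / s)"
    by simp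
  \<comment> \<open>Cancelling \<open>prob G\<close> relies on the positive probability of the
    chosen path.\<close>
  then have "D\<^sup>2 * \<epsilon>\<^sup>2 \<le> D\<^sup>2 * (12 / s)"
    using Gpos by (subst (asm) mult_le_cancel_left_pos) (simp_all add: mult_ac)
  then have "\<epsilon>\<^sup>2 \<le> 12 / s"
    using \<open>D > 0\<close> by (subst (asm) mult_le_cancel_left_pos) auto
  moreover have "12 / s < \<epsilon>\<^sup>2"
    using n \<open>0 < \<epsilon>\<close> s unfolding s_def[symmetric] by (simp add: field_simps)
  ultimately show False
    by linarith
qed

end

theorem theorem4:
  fixes N :: nat and E :: "nat set set" and \<alpha> :: real
    and M :: "'a measure" and C :: "nat \<Rightarrow> 'a \<Rightarrow> bool" and X :: "nat \<Rightarrow> nat \<Rightarrow> 'a \<Rightarrow> nat"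
    and Zbar :: "'a \<Rightarrow> real"
  assumes "N \<ge> 2"
    and "simple_graph {1..N} E" and "graph_connected {1..N} E"
    and "0 < \<alpha>" and "\<alpha> < 1"
    and "interacting_urn M {1..N} E \<alpha> C X"
    and "Zbar \<in> borel_measurable M"
    and "\<forall>i\<in>{1..N}. AE w in M. (\<lambda>t. urn_prop E C X i t w) \<longlonglongrightarrow> Zbar w"
  shows "(\<nexists>c. distr M borel Zbar = return borel c) \<and>
    (\<forall>O'. openin (top_of_set {0..1}) O' \<longrightarrow> O' \<noteq> {} \<longrightarrow>
       measure M {w\<in>space M. Zbar w \<in> O'} > 0)"
proof -
  interpret interacting_urn M "{1..N}" E \<alpha> C X
    by fact
  interpret isolated_free_urn M "{1..N}" E \<alpha> C X
  proof
    fix i assume i: "i \<in> {1..N}"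
    \<comment> \<open>Any vertex other than \<open>i\<close> serves: a path from \<open>i\<close> to
      it starts with an edge at \<open>i\<close>.\<close>
    define j where "j = (if i = 1 then 2 else 1 :: nat)"
    have "(i, j) \<in> {(x, y). y \<in> neighbors E x}\<^sup>*"
      using assms(1,3) i unfolding graph_connected_def by (auto simp: j_def)
    moreover have "i \<noteq> j"
      by (auto simp: j_def)
    ultimately show "neighbors E i \<noteq> {}"
      by (auto elim: converse_rtranclE)
  qed fact
  have [measurable]: "Zbar \<in> borel_measurable M"
    by fact
  \<comment> \<open>A ball around a point of \<open>U\<close> may leave the unit interval, where
    relative openness says nothing; almost surely the limit does not go there.\<close>
  have unit: "AE w in M. Zbar w \<in> {0..1}"
  proof -
    have "AE w in M. (\<lambda>t. Z 1 t w) \<longlonglongrightarrow> Zbar w"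
      using assms(1,8) by simp
    then show ?thesis
    proof eventually_elim
      case (elim w)
      then show ?case
        using LIMSEQ_le_const[OF elim, of 0] LIMSEQ_le_const2[OF elim, of 1]
        by (auto simp: urn_prop_bounds)
    qed
  qed
  have support: "measure M {w\<in>space M. Zbar w \<in> U} > 0"
    if U: "openin (top_of_set {0..1}) U" "U \<noteq> {}" for U
  proof -
    obtain T where T: "open T" "U = {0..1} \<inter> T"
      using U(1) by (auto simp: openin_open)
    obtain p where p: "p \<in> U"
      using U(2) by blast
    then obtain \<epsilon> where \<epsilon>: "\<epsilon> > 0" "ball p \<epsilon> \<subseteq> T"
      using T open_contains_ball by (metis IntD2)
    have [measurable]: "U \<in> sets borel"
      using T by auto
    have "0 < prob {w \<in> space M. \<bar>Zbar w - p\<bar> < \<epsilon>}"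
      by (rule limit_near_pos) (use assms p T \<epsilon> in auto)
    also have "\<dots> \<le> prob {w \<in> space M. Zbar w \<in> U}"
    proof (rule finite_measure_mono_AE)
      show "AE w in M. w \<in> {w \<in> space M. \<bar>Zbar w - p\<bar> < \<epsilon>} \<longrightarrow> w \<in> {w \<in> space M. Zbar w \<in> U}"
        using unit
        by eventually_elim (use T \<epsilon> in \<open>auto simp: ball_def dist_real_def abs_minus_commute subset_iff\<close>)
    qed measurable
    finally show ?thesis .
  qed
  moreover have "distr M borel Zbar \<noteq> return borel c" for c
  proof
    assume eq: "distr M borel Zbar = return borel c"
    \<comment> \<open>A nonempty relatively open set that is null for the point mass at
      \<open>c\<close>, contrary to full support.\<close>
    define U where "U = {0..1} - {c}"
    have "openin (top_of_set {0..1}) U"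
      unfolding U_def openin_open by (intro exI[of _ "- {c}"]) auto
    moreover have "U \<noteq> {}"
      proof -
      have "(if c = 0 then 1 else 0) \<in> U"
        by (simp add: U_def)
      then show ?thesis
        by blast
    qed
    ultimately have "0 < prob {w \<in> space M. Zbar w \<in> U}"
      by (rule support)
    also have "{w \<in> space M. Zbar w \<in> U} = Zbar -` U \<inter> space M"
      by auto
    also have "prob \<dots> = measure (distr M borel Zbar) U"
      by (subst measure_distr) (auto simp: U_def)
    also have "\<dots> = 0"
      unfolding eq by (subst measure_return) (auto simp: U_def)
    finally show False
      by simp
  qed
  ultimately show ?thesis
    by blast
qed

end
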